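(* For periodic or zero boundary conditions, any combination of one of the two time discretizations (first-order splitting; second-order IMEX Runge–Kutta) with one of the two space discretizations (first-order flux; second-order flux) described in the context conserves mass, total momentum and total energy; that is, for every step $\ell\to\ell+1$, $$\sum_{k=0}^K\int m_if_{i,k}^{\ell+1}d\mathbf v\,\Delta x=\sum_{k=0}^K\int m_if_{i,k}^{\ell}d\mathbf v\,\Delta x\quad(i=1,2),$$ $$\sum_{k=0}^K\int\begin{pmatrix}\mathbf v\\|\mathbf v|^2\end{pmatrix}\big(m_1f_{1,k}^{\ell+1}+m_2f_{2,k}^{\ell+1}\big)d\mathbf v\,\Delta x=\sum_{k=0}^K\int\begin{pmatrix}\mathbf v\\|\mathbf v|^2\end{pmatrix}\big(m_1f_{1,k}^{\ell}+m_2f_{2,k}^{\ell}\big)d\mathbf v\,\Delta x.$$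
   Context: Species $i\in\{1,2\}$, with $j$ the other index; masses $m_i>0$; $\mathbf v=(v^1,v^2,v^3)\in\mathbb R^3$; integrals over $\mathbb R^3$; $\Delta t,\Delta x>0$; cells $k\in\{0,\dots,K\}$. Let $\mathbf a_i=m_i(1,\mathbf v,|\mathbf v|^2)^\top$, $\mathbf a_{12}=m_1(1,0,\mathbf v,|\mathbf v|^2)^\top$, $\mathbf a_{21}=m_2(0,1,\mathbf v,|\mathbf v|^2)^\top$, $\Lambda=\mathbb R\times\mathbb R^3\times(-\infty,0)$, $\Lambda_{12}=\mathbb R\times\mathbb R\times\mathbb R^3\times(-\infty,0)$. Implicit stage (performed in each cell): given functions $G_1,G_2$ of $\mathbf v$, $\tau>0$ and frequencies $\nu_{ij}(\mathbf v)\ge0$, set $c_i=\frac1{1+\tau(\nu_{ii}+\nu_{ij})}$; let $\boldsymbol\lambda_i$ be the minimizer over $\boldsymbol\alpha\in\Lambda$ of $\int c_i\nu_{ii}e^{\boldsymbol\alpha\cdot\mathbf a_i}d\mathbf v-\boldsymbol\alpha\cdot\int c_i\nu_{ii}G_i\mathbf a_i\,d\mathbf v$ and $\boldsymbol\lambda$ the minimizer over $\boldsymbol\alpha\in\Lambda_{12}$ of $\int[c_1\nu_{12}e^{\boldsymbol\alpha\cdot\mathbf a_{12}}+c_2\nu_{21}e^{\boldsymbol\alpha\cdot\mathbf a_{21}}]d\mathbf v-\boldsymbol\alpha\cdot\int[c_1\nu_{12}G_1\mathbf a_{12}+c_2\nu_{21}G_2\mathbf a_{21}]d\mathbf v$;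 put $A_{ii}=e^{\boldsymbol\lambda_i\cdot\mathbf a_i}$, $A_{12}=e^{\boldsymbol\lambda\cdot\mathbf a_{12}}$, $A_{21}=e^{\boldsymbol\lambda\cdot\mathbf a_{21}}$. The stage returns $\psi_i=c_iG_i+c_i\tau(\nu_{ii}A_{ii}+\nu_{ij}A_{ij})$, equivalently $\psi_i=G_i+\tau\mathcal R_i$ with $\mathcal R_i=\nu_{ii}(A_{ii}-\psi_i)+\nu_{ij}(A_{ij}-\psi_i)$. Standing assumption: the integrals are finite for all $\boldsymbol\alpha$ in $\Lambda$, resp. $\Lambda_{12}$, the minimizers exist and are unique, and all distribution functions and fluxes have finite moments up to order two. Discrete transport: $\mathcal T_k(g)=\frac1{\Delta x}(\mathscr F_{k+\frac12}(g)-\mathscr F_{k-\frac12}(g))$, $\mathscr F_{k+\frac12}(g)=\frac{v^1}2(g_{k+1}+g_k)-\frac{|v^1|}2(g_{k+1}-g_k-\phi_{k+\frac12}(g))$, with $\phi_{k+\frac12}=0$ (first-order flux) or $\phi_{k+\frac12}(g)=\operatorname{minmod}(g_k-g_{k-1},g_{k+1}-g_k,g_{k+2}-g_{k+1})$ (second-order flux), where $\operatorname{minmod}(a,b,c)=s\min(|a|,|b|,|c|)$ if $a,b,c$ have the same sign $s$ and $0$ otherwise. Ghost-cell values come from the boundary conditions: periodic (periodic extension, so $\mathscr F_{K+\frac12}=\mathscr F_{-\frac12}$) or zero ($\mathscr F_{K+\frac12}=\mathscr F_{-\frac12}=0$) in every evaluation of the transport operator. First-order splitting: $f_i^{\ell'}$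 is the result of the implicit stage with $G_i=f_i^\ell$, $\tau=\Delta t$ and frequencies $\nu_{ij}^\ell$; then $f_{i,k}^{\ell+1}=f_{i,k}^{\ell'}-\Delta t\,\mathcal T_k(f_i^{\ell'})$. Second-order IMEX Runge–Kutta: with $\gamma=1-\frac{\sqrt2}2$, $\delta=1-\frac1{2\gamma}$, $\tau=\gamma\Delta t$: $G_i^{(1)}=f_i^\ell-\gamma\Delta t\,\mathcal T(f_i^\ell)$; $f_i^{(1)}$ and $\mathcal R_i^{(1)}$ result from the implicit stage with data $G^{(1)}$; $G_i^{(2)}=f_i^\ell-\delta\Delta t\,\mathcal T(f_i^\ell)-(1-\delta)\Delta t\,\mathcal T(f_i^{(1)})+(1-\gamma)\Delta t\,\mathcal R_i^{(1)}$; $f_i^{(2)}$ results from the implicit stage with data $G^{(2)}$; $f_i^{\ell+1}=f_i^{(2)}$. In stage $r$ the frequencies are nonnegative functions $\nu_{ij}^{(r)}(\mathbf v)$ evaluated from $G^{(r)}$. *)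

theory Defs
  imports "HOL-Analysis.Analysis"
begin

datatype species = S1 | S2

fun other :: "species \<Rightarrow> species" where
  "other S1 = S2"
| "other S2 = S1"

datatype boundary = Periodic | Zero
datatype time_disc = Splitting | IMEX_RK
datatype space_disc = First_Order_Flux | Second_Order_Flux

type_synonym vel = "real^3"

text \<open>Cells are indexed by integers: \<open>{0..int K}\<close> are the cells of the domain, all other indices are
  ghost cells. The interface \<open>k + 1/2\<close> is denoted by \<open>k\<close>. A frequency \<open>\<nu> i j\<close> is the collision
  frequency of species \<open>i\<close> with species \<open>j\<close>.\<close>

type_synonym grid = "int \<Rightarrow> vel \<Rightarrow> real"
type_synonym dist = "species \<Rightarrow> grid"
type_synonym freq = "species \<Rightarrow> species \<Rightarrow> vel \<Rightarrow> real"


definition a_self :: "(species \<Rightarrow> real) \<Rightarrow> species \<Rightarrow> vel \<Rightarrow> real \<times> vel \<times> real" where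
  "a_self m i v = m i *\<^sub>R (1, v, (norm v)\<^sup>2)"

text \<open>\<open>a_mix m S1\<close> and \<open>a_mix m S2\<close> are the vectors \<open>a\<^sub>1\<^sub>2\<close> and \<open>a\<^sub>2\<^sub>1\<close>, respectively.\<close>

fun a_mix :: "(species \<Rightarrow> real) \<Rightarrow> species \<Rightarrow> vel \<Rightarrow> real \<times> real \<times> vel \<times> real" where
  "a_mix m S1 v = m S1 *\<^sub>R (1, 0, v, (norm v)\<^sup>2)"
| "a_mix m S2 v = m S2 *\<^sub>R (0, 1, v, (norm v)\<^sup>2)"

definition Lambda_self :: "(real \<times> vel \<times> real) set" where
  "Lambda_self = UNIV \<times> UNIV \<times> {..<0}"

definition Lambda_mix :: "(real \<times> real \<times> vel \<times> real) set" where
  "Lambda_mix = UNIV \<times> UNIV \<times> UNIV \<times> {..<0}"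

definition coeff :: "real \<Rightarrow> freq \<Rightarrow> species \<Rightarrow> vel \<Rightarrow> real" where
  "coeff \<tau> \<nu> i v = 1 / (1 + \<tau> * (\<nu> i i v + \<nu> i (other i) v))"

definition exp_self :: "(species \<Rightarrow> real) \<Rightarrow> real \<Rightarrow> freq \<Rightarrow> species \<Rightarrow> real \<times> vel \<times> real \<Rightarrow> vel \<Rightarrow> real"
  where "exp_self m \<tau> \<nu> i \<alpha> v = coeff \<tau> \<nu> i v * \<nu> i i v * exp (\<alpha> \<bullet> a_self m i v)"

definition data_self ::
  "(species \<Rightarrow> real) \<Rightarrow> real \<Rightarrow> freq \<Rightarrow> (species \<Rightarrow> vel \<Rightarrow> real) \<Rightarrow> species \<Rightarrow> vel \<Rightarrow> real \<times> vel \<times> real"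
  where "data_self m \<tau> \<nu> G i v = (coeff \<tau> \<nu> i v * \<nu> i i v * G i v) *\<^sub>R a_self m i v"

definition potential_self ::
  "(species \<Rightarrow> real) \<Rightarrow> real \<Rightarrow> freq \<Rightarrow> (species \<Rightarrow> vel \<Rightarrow> real) \<Rightarrow> species \<Rightarrow> real \<times> vel \<times> real \<Rightarrow> real"
  where "potential_self m \<tau> \<nu> G i \<alpha> =
    (LINT v|lborel. exp_self m \<tau> \<nu> i \<alpha> v) - \<alpha> \<bullet> (LINT v|lborel. data_self m \<tau> \<nu> G i v)"

definition exp_mix :: "(species \<Rightarrow> real) \<Rightarrow> real \<Rightarrow> freq \<Rightarrow> real \<times> real \<times> vel \<times> real \<Rightarrow> vel \<Rightarrow> real"
  where "exp_mix m \<tau> \<nu> \<alpha> v =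
    coeff \<tau> \<nu> S1 v * \<nu> S1 S2 v * exp (\<alpha> \<bullet> a_mix m S1 v)
    + coeff \<tau> \<nu> S2 v * \<nu> S2 S1 v * exp (\<alpha> \<bullet> a_mix m S2 v)"

definition data_mix ::
  "(species \<Rightarrow> real) \<Rightarrow> real \<Rightarrow> freq \<Rightarrow> (species \<Rightarrow> vel \<Rightarrow> real) \<Rightarrow> vel \<Rightarrow> real \<times> real \<times> vel \<times> real"
  where "data_mix m \<tau> \<nu> G v =
    (coeff \<tau> \<nu> S1 v * \<nu> S1 S2 v * G S1 v) *\<^sub>R a_mix m S1 v
    + (coeff \<tau> \<nu> S2 v * \<nu> S2 S1 v * G S2 v) *\<^sub>R a_mix m S2 v"

definition potential_mix ::
  "(species \<Rightarrow> real) \<Rightarrow> real \<Rightarrow> freq \<Rightarrow> (species \<Rightarrow> vel \<Rightarrow> real) \<Rightarrow> real \<times> real \<times> vel \<times> real \<Rightarrow> real"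
  where "potential_mix m \<tau> \<nu> G \<alpha> =
    (LINT v|lborel. exp_mix m \<tau> \<nu> \<alpha> v) - \<alpha> \<bullet> (LINT v|lborel. data_mix m \<tau> \<nu> G v)"

text \<open>\<open>arg_min\<close> is the unique minimizer only under \<open>stage_wellposed\<close> below.\<close>

definition lam_self ::
  "(species \<Rightarrow> real) \<Rightarrow> real \<Rightarrow> freq \<Rightarrow> (species \<Rightarrow> vel \<Rightarrow> real) \<Rightarrow> species \<Rightarrow> real \<times> vel \<times> real"
  where "lam_self m \<tau> \<nu> G i = arg_min (potential_self m \<tau> \<nu> G i) (\<lambda>\<alpha>. \<alpha> \<in> Lambda_self)"

definition lam_mix ::
  "(species \<Rightarrow> real) \<Rightarrow> real \<Rightarrow> freq \<Rightarrow> (species \<Rightarrow> vel \<Rightarrow> real) \<Rightarrow> real \<times> real \<times> vel \<times> real"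
  where "lam_mix m \<tau> \<nu> G = arg_min (potential_mix m \<tau> \<nu> G) (\<lambda>\<alpha>. \<alpha> \<in> Lambda_mix)"

definition stage_wellposed ::
  "(species \<Rightarrow> real) \<Rightarrow> real \<Rightarrow> freq \<Rightarrow> (species \<Rightarrow> vel \<Rightarrow> real) \<Rightarrow> bool"
  where "stage_wellposed m \<tau> \<nu> G \<longleftrightarrow>
    (\<forall>i. (\<forall>\<alpha>\<in>Lambda_self. integrable lborel (exp_self m \<tau> \<nu> i \<alpha>))
       \<and> integrable lborel (data_self m \<tau> \<nu> G i)
       \<and> (\<exists>!\<alpha>. is_arg_min (potential_self m \<tau> \<nu> G i) (\<lambda>\<alpha>. \<alpha> \<in> Lambda_self) \<alpha>))
    \<and> (\<forall>\<alpha>\<in>Lambda_mix. integrable lborel (exp_mix m \<tau> \<nu> \<alpha>))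
    \<and> integrable lborel (data_mix m \<tau> \<nu> G)
    \<and> (\<exists>!\<alpha>. is_arg_min (potential_mix m \<tau> \<nu> G) (\<lambda>\<alpha>. \<alpha> \<in> Lambda_mix) \<alpha>)"

definition A_self ::
  "(species \<Rightarrow> real) \<Rightarrow> real \<Rightarrow> freq \<Rightarrow> (species \<Rightarrow> vel \<Rightarrow> real) \<Rightarrow> species \<Rightarrow> vel \<Rightarrow> real"
  where "A_self m \<tau> \<nu> G i v = exp (lam_self m \<tau> \<nu> G i \<bullet> a_self m i v)"

definition A_mix ::
  "(species \<Rightarrow> real) \<Rightarrow> real \<Rightarrow> freq \<Rightarrow> (species \<Rightarrow> vel \<Rightarrow> real) \<Rightarrow> species \<Rightarrow> vel \<Rightarrow> real"
  where "A_mix m \<tau> \<nu> G i v = exp (lam_mix m \<tau> \<nu> G \<bullet> a_mix m i v)"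

definition stage_psi ::
  "(species \<Rightarrow> real) \<Rightarrow> real \<Rightarrow> freq \<Rightarrow> (species \<Rightarrow> vel \<Rightarrow> real) \<Rightarrow> species \<Rightarrow> vel \<Rightarrow> real"
  where "stage_psi m \<tau> \<nu> G i v =
    coeff \<tau> \<nu> i v * G i v
    + coeff \<tau> \<nu> i v * \<tau> * (\<nu> i i v * A_self m \<tau> \<nu> G i v + \<nu> i (other i) v * A_mix m \<tau> \<nu> G i v)"

definition stage_R ::
  "(species \<Rightarrow> real) \<Rightarrow> real \<Rightarrow> freq \<Rightarrow> (species \<Rightarrow> vel \<Rightarrow> real) \<Rightarrow> species \<Rightarrow> vel \<Rightarrow> real"
  where "stage_R m \<tau> \<nu> G i v =
    \<nu> i i v * (A_self m \<tau> \<nu> G i v - stage_psi m \<tau> \<nu> G i v)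
    + \<nu> i (other i) v * (A_mix m \<tau> \<nu> G i v - stage_psi m \<tau> \<nu> G i v)"

lemma stage_psi_eq_R:
  assumes "\<tau> > 0" "\<And>i j v. 0 \<le> \<nu> i j v"
  shows "stage_psi m \<tau> \<nu> G i v = G i v + \<tau> * stage_R m \<tau> \<nu> G i v"
proof -
  have "0 \<le> \<tau> * (\<nu> i i v + \<nu> i (other i) v)"
    using assms by simp
  then have "1 + \<tau> * (\<nu> i i v + \<nu> i (other i) v) \<noteq> 0"
    by linarith
  then have "coeff \<tau> \<nu> i v * (1 + \<tau> * (\<nu> i i v + \<nu> i (other i) v)) = 1"
    by (simp add: coeff_def)
  then show ?thesis
    unfolding stage_R_def stage_psi_def by algebra
qed


definition minmod :: "real \<Rightarrow> real \<Rightarrow> real \<Rightarrow> real" where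
  "minmod a b c =
    (if sgn a = sgn b \<and> sgn b = sgn c then sgn a * min \<bar>a\<bar> (min \<bar>b\<bar> \<bar>c\<bar>) else 0)"

fun limiter :: "space_disc \<Rightarrow> grid \<Rightarrow> int \<Rightarrow> vel \<Rightarrow> real" where
  "limiter First_Order_Flux g k v = 0"
| "limiter Second_Order_Flux g k v =
     minmod (g k v - g (k - 1) v) (g (k + 1) v - g k v) (g (k + 2) v - g (k + 1) v)"

text \<open>Grid functions carry their ghost-cell values. For periodic boundary conditions these are the
  periodic extension. For zero boundary conditions the two boundary fluxes vanish; the ghost-cell
  values, which still enter the limiter at the outermost interior interfaces, are left arbitrary.
  Ghost-cell values for which the flux formula itself vanishes at the boundary are a special case.\<close>

definition ghost_values :: "boundary \<Rightarrow> nat \<Rightarrow> grid \<Rightarrow> bool" where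
  "ghost_values bc K g \<longleftrightarrow> (bc = Periodic \<longrightarrow> (\<forall>k. g (k + (int K + 1)) = g k))"

definition flux :: "boundary \<Rightarrow> space_disc \<Rightarrow> nat \<Rightarrow> grid \<Rightarrow> int \<Rightarrow> vel \<Rightarrow> real" where
  "flux bc sd K g k v =
    (if bc = Zero \<and> (k = -1 \<or> k = int K) then 0
     else v $ 1 / 2 * (g (k + 1) v + g k v)
          - \<bar>v $ 1\<bar> / 2 * (g (k + 1) v - g k v - limiter sd g k v))"

definition transport :: "boundary \<Rightarrow> space_disc \<Rightarrow> nat \<Rightarrow> real \<Rightarrow> grid \<Rightarrow> int \<Rightarrow> vel \<Rightarrow> real" where
  "transport bc sd K \<Delta>x g k v = 1 / \<Delta>x * (flux bc sd K g k v - flux bc sd K g (k - 1) v)"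


definition finite_moments :: "(vel \<Rightarrow> real) \<Rightarrow> bool" where
  "finite_moments g \<longleftrightarrow> integrable lborel (\<lambda>v. g v *\<^sub>R (1::real, v, (norm v)\<^sup>2))"

definition dist_moments :: "nat \<Rightarrow> dist \<Rightarrow> bool" where
  "dist_moments K f \<longleftrightarrow> (\<forall>i. \<forall>k\<in>{0..int K}. finite_moments (f i k))"

definition flux_moments :: "boundary \<Rightarrow> space_disc \<Rightarrow> nat \<Rightarrow> dist \<Rightarrow> bool" where
  "flux_moments bc sd K f \<longleftrightarrow> (\<forall>i. \<forall>k\<in>{-1..int K}. finite_moments (flux bc sd K (f i) k))"

definition freq_at :: "(species \<Rightarrow> species \<Rightarrow> grid) \<Rightarrow> int \<Rightarrow> freq" where
  "freq_at \<nu> k = (\<lambda>i j. \<nu> i j k)"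

definition dist_at :: "dist \<Rightarrow> int \<Rightarrow> species \<Rightarrow> vel \<Rightarrow> real" where
  "dist_at G k = (\<lambda>i. G i k)"

definition splitting_step ::
  "(species \<Rightarrow> real) \<Rightarrow> real \<Rightarrow> real \<Rightarrow> nat \<Rightarrow> boundary \<Rightarrow> space_disc
    \<Rightarrow> (species \<Rightarrow> species \<Rightarrow> grid) \<Rightarrow> dist \<Rightarrow> dist \<Rightarrow> dist \<Rightarrow> bool"
  where "splitting_step m \<Delta>t \<Delta>x K bc sd \<nu> f f' fnew \<longleftrightarrow>
    (\<forall>i. ghost_values bc K (f' i)) \<and>
    (\<forall>i. \<forall>k\<in>{0..int K}. \<forall>v.
       f' i k v = stage_psi m \<Delta>t (freq_at \<nu> k) (dist_at f k) i v \<and>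
       fnew i k v = f' i k v - \<Delta>t * transport bc sd K \<Delta>x (f' i) k v)"

definition splitting_standing ::
  "(species \<Rightarrow> real) \<Rightarrow> real \<Rightarrow> nat \<Rightarrow> boundary \<Rightarrow> space_disc
    \<Rightarrow> (species \<Rightarrow> species \<Rightarrow> grid) \<Rightarrow> dist \<Rightarrow> dist \<Rightarrow> dist \<Rightarrow> bool"
  where "splitting_standing m \<Delta>t K bc sd \<nu> f f' fnew \<longleftrightarrow>
    (\<forall>k\<in>{0..int K}. stage_wellposed m \<Delta>t (freq_at \<nu> k) (dist_at f k)) \<and>
    dist_moments K f \<and> dist_moments K f' \<and> dist_moments K fnew \<and>
    flux_moments bc sd K f'"

definition imex_gamma :: real where
  "imex_gamma = 1 - sqrt 2 / 2"

definition imex_delta :: real where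
  "imex_delta = 1 - 1 / (2 * imex_gamma)"

definition imex_step ::
  "(species \<Rightarrow> real) \<Rightarrow> real \<Rightarrow> real \<Rightarrow> nat \<Rightarrow> boundary \<Rightarrow> space_disc
    \<Rightarrow> (nat \<Rightarrow> species \<Rightarrow> species \<Rightarrow> grid) \<Rightarrow> dist \<Rightarrow> dist \<Rightarrow> dist \<Rightarrow> dist \<Rightarrow> dist \<Rightarrow> dist \<Rightarrow> bool"
  where "imex_step m \<Delta>t \<Delta>x K bc sd \<nu> f G1 f1 G2 f2 fnew \<longleftrightarrow>
    (let \<gamma> = imex_gamma; \<delta> = imex_delta; \<tau> = \<gamma> * \<Delta>t in
      (\<forall>i. ghost_values bc K (f i) \<and> ghost_values bc K (f1 i)) \<and>
      (\<forall>i. \<forall>k\<in>{0..int K}. \<forall>v.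
         G1 i k v = f i k v - \<gamma> * \<Delta>t * transport bc sd K \<Delta>x (f i) k v \<and>
         f1 i k v = stage_psi m \<tau> (freq_at (\<nu> 1) k) (dist_at G1 k) i v \<and>
         G2 i k v = f i k v
           - \<delta> * \<Delta>t * transport bc sd K \<Delta>x (f i) k v
           - (1 - \<delta>) * \<Delta>t * transport bc sd K \<Delta>x (f1 i) k v
           + (1 - \<gamma>) * \<Delta>t * stage_R m \<tau> (freq_at (\<nu> 1) k) (dist_at G1 k) i v \<and>
         f2 i k v = stage_psi m \<tau> (freq_at (\<nu> 2) k) (dist_at G2 k) i v \<and>
         fnew i k v = f2 i k v))"

definition imex_standing ::
  "(species \<Rightarrow> real) \<Rightarrow> real \<Rightarrow> nat \<Rightarrow> boundary \<Rightarrow> space_disc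
    \<Rightarrow> (nat \<Rightarrow> species \<Rightarrow> species \<Rightarrow> grid) \<Rightarrow> dist \<Rightarrow> dist \<Rightarrow> dist \<Rightarrow> dist \<Rightarrow> dist \<Rightarrow> dist \<Rightarrow> bool"
  where "imex_standing m \<Delta>t K bc sd \<nu> f G1 f1 G2 f2 fnew \<longleftrightarrow>
    (\<forall>k\<in>{0..int K}.
       stage_wellposed m (imex_gamma * \<Delta>t) (freq_at (\<nu> 1) k) (dist_at G1 k) \<and>
       stage_wellposed m (imex_gamma * \<Delta>t) (freq_at (\<nu> 2) k) (dist_at G2 k)) \<and>
    dist_moments K f \<and> dist_moments K f1 \<and> dist_moments K f2 \<and> dist_moments K fnew \<and>
    flux_moments bc sd K f \<and> flux_moments bc sd K f1"

end

(* The exponential potentials are differentiable at their minimizers, which are interior points, and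
   the optimality conditions say that c_i nu_ii (A_ii - G_i) has vanishing moments against a_i and
   that the corresponding cross terms have vanishing moments against (a_12, a_21). Since
   R_i = c_i nu_ii (A_ii - G_i) + c_i nu_ij (A_ij - G_i), the collision term of an implicit stage has
   no mass, total momentum or total energy. Summed over the cells, the transport term telescopes to
   the difference of the two boundary fluxes, which vanishes for both boundary conditions. Both time
   discretizations add to f only multiples of transport and collision terms. *)

theory Submission
  imports Defs
begin

section \<open>First-order optimality for exponential potentials\<close>

text \<open>Convexity of \<open>exp\<close> makes the quotient increase with \<open>t\<close>, so
  its value at \<open>e\<close> bounds it above; the tangent at 0 bounds it below. The bound is free
  of \<open>t\<close> and built from exponentials at shifts \<open>e\<close> and \<open>- e\<close>,
  so it can serve as an integrable majorant.\<close>

lemma exp_diff_quotient_bound: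
  fixes t e x :: real
  assumes "0 < t" "t \<le> e"
  shows "\<bar>(exp (t * x) - 1) / t\<bar> \<le> (exp (e * x) + exp (- (e * x))) / e"
proof -
  have e: "0 < e" using assms by simp
  have "exp ((1 - t / e) *\<^sub>R 0 + (t / e) *\<^sub>R (e * x)) \<le> (1 - t / e) * exp 0 + (t / e) * exp (e * x)"
    using convex_onD[OF exp_convex, of "t / e" 0 "e * x"] assms e by simp
  then have "exp (t * x) - 1 \<le> t * ((exp (e * x) - 1) / e)"
    using e by (simp add: algebra_simps diff_divide_distrib)
  then have "(exp (t * x) - 1) / t \<le> (exp (e * x) - 1) / e"
    using assms by (simp add: pos_divide_le_eq mult.commute)
  also have "\<dots> \<le> (exp (e * x) + exp (- (e * x))) / e"
    using e exp_ge_zero[of "- (e * x)"] by (intro divide_right_mono) linarith+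
  finally have upper: "(exp (t * x) - 1) / t \<le> (exp (e * x) + exp (- (e * x))) / e" .
  \<comment> \<open>The tangent inequality at \<open>- (e * x)\<close> gives
    \<open>e * x \<ge> 1 - exp (- (e * x))\<close>.\<close>
  have "- (exp (e * x) + exp (- (e * x))) \<le> e * x"
    using exp_ge_add_one_self[of "- (e * x)"] exp_gt_zero[of "e * x"] by linarith
  then have "- ((exp (e * x) + exp (- (e * x))) / e) \<le> x"
    using e by (simp add: field_simps)
  also have "x \<le> (exp (t * x) - 1) / t"
    using assms exp_ge_add_one_self[of "t * x"] by (simp add: field_simps)
  finally show ?thesis using upper by linarith
qed

lemma exp_diff_quotient_tendsto:
  fixes x :: real
  assumes "t \<longlonglongrightarrow> 0" "\<And>n. t n \<noteq> 0"
  shows "(\<lambda>n. (exp (t n * x) - 1) / t n) \<longlonglongrightarrow> x"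
proof -
  have "((\<lambda>s. exp (s * x)) has_real_derivative x) (at 0)"
    by (auto intro!: derivative_eq_intros)
  then have "((\<lambda>s. (exp (s * x) - 1) / s) \<longlongrightarrow> x) (at 0)"
    by (simp add: has_field_derivative_iff)
  moreover have "filterlim t (at 0) sequentially"
    using assms by (simp add: filterlim_at)
  ultimately show ?thesis
    by (rule filterlim_compose)
qed

text \<open>Difference quotients of the potential along \<open>d\<close> are nonnegative at a
  minimizer, and dominated convergence passes to the limit. Only positive increments are used, hence
  an inequality; integrability of the derivative comes out of the same limit. The index set
  \<open>I\<close> lets one lemma cover both the one-species and the two-species potential.\<close>

lemma exp_minimizer_directional:
  fixes a :: "'i \<Rightarrow> 'v \<Rightarrow> 'e::euclidean_space" and w :: "'i \<Rightarrow> 'v \<Rightarrow> real"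
  assumes "open L"
    and nonneg: "\<And>i v. i \<in> I \<Longrightarrow> 0 \<le> w i v"
    and int: "\<And>\<alpha>. \<alpha> \<in> L \<Longrightarrow> integrable N (\<lambda>v. \<Sum>i\<in>I. w i v * exp (\<alpha> \<bullet> a i v))"
    and min: "is_arg_min (\<lambda>\<alpha>. (LINT v|N. (\<Sum>i\<in>I. w i v * exp (\<alpha> \<bullet> a i v))) - \<alpha> \<bullet> M) (\<lambda>\<alpha>. \<alpha> \<in> L) lam"
  shows "integrable N (\<lambda>v. \<Sum>i\<in>I. w i v * exp (lam \<bullet> a i v) * (d \<bullet> a i v))" (is "integrable N ?D")
    and "d \<bullet> M \<le> (LINT v|N. (\<Sum>i\<in>I. w i v * exp (lam \<bullet> a i v) * (d \<bullet> a i v)))"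
proof -
  define p where "p t v = (\<Sum>i\<in>I. w i v * exp ((lam + t *\<^sub>R d) \<bullet> a i v))" for t v
  have p: "p t v = (\<Sum>i\<in>I. w i v * exp (lam \<bullet> a i v) * exp (t * (d \<bullet> a i v)))" for t v
    by (simp add: p_def inner_add_left exp_add mult.assoc)
  have lam: "lam \<in> L" using min by (simp add: is_arg_min_def)
  then obtain r where r: "0 < r" "cball lam r \<subseteq> L"
    using \<open>open L\<close> open_contains_cball by blast
  \<comment> \<open>Chosen so that \<open>\<bar>t\<bar> \<le> e\<close> keeps
    \<open>lam + t *\<^sub>R d\<close> in the ball of radius \<open>r\<close>; the summand 1 covers
    \<open>d = 0\<close>.\<close>
  define e where "e = r / (1 + norm d)"
  have d: "0 < 1 + norm d" by (simp add: add_pos_nonneg)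
  then have e: "0 < e" using r by (simp add: e_def)
  have line: "lam + t *\<^sub>R d \<in> L" if "\<bar>t\<bar> \<le> e" for t
  proof -
    have "norm (t *\<^sub>R d) \<le> e * (1 + norm d)"
      unfolding norm_scaleR using that e by (intro mult_mono) auto
    also have "\<dots> = r" using d by (simp add: e_def)
    finally show ?thesis using r by (auto simp: dist_norm)
  qed
  have int_p: "integrable N (p t)" if "\<bar>t\<bar> \<le> e" for t
    using int[OF line[OF that]] by (simp add: p_def[abs_def])
  \<comment> \<open>A sequence of positive increments at most \<open>e\<close>, since dominated
    convergence is applied along sequences.\<close>
  define t where "t n = e / Suc n" for n
  define q where "q n v = (p (t n) v - p 0 v) / t n" for n v
  have t: "0 < t n" "t n \<le> e" for n
    using e by (auto simp: t_def field_simps)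
  have "t \<longlonglongrightarrow> 0"
    unfolding t_def using LIMSEQ_Suc[OF lim_const_over_n[of e]] by simp
  note t_tendsto = exp_diff_quotient_tendsto[OF this less_imp_neq[OF t(1), symmetric]]
  have q: "q n v = (\<Sum>i\<in>I. w i v * exp (lam \<bullet> a i v) * ((exp (t n * (d \<bullet> a i v)) - 1) / t n))" for n v
    by (simp add: q_def p sum_subtractf[symmetric] sum_divide_distrib algebra_simps)
  have q_tendsto: "(\<lambda>n. q n v) \<longlonglongrightarrow> ?D v" for v
    unfolding q by (intro tendsto_sum tendsto_mult_left t_tendsto)
  \<comment> \<open>The nonnegative weights allow a termwise estimate; the majorant is made of the
    integrands at the two admissible points \<open>lam + e *\<^sub>R d\<close> and
    \<open>lam - e *\<^sub>R d\<close>.\<close>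
  have q_bound: "norm (q n v) \<le> (p e v + p (- e) v) / e" for n v
  proof -
    have "norm (q n v) \<le> (\<Sum>i\<in>I. norm (w i v * exp (lam \<bullet> a i v) * ((exp (t n * (d \<bullet> a i v)) - 1) / t n)))"
      unfolding q by (rule norm_sum)
    also have "\<dots> \<le> (\<Sum>i\<in>I. w i v * exp (lam \<bullet> a i v)
        * ((exp (e * (d \<bullet> a i v)) + exp (- (e * (d \<bullet> a i v)))) / e))"
      unfolding real_norm_def abs_mult using nonneg exp_diff_quotient_bound[OF t]
      by (intro sum_mono mult_mono) auto
    also have "\<dots> = (p e v + p (- e) v) / e"
      by (simp add: p sum.distrib[symmetric] sum_divide_distrib algebra_simps add_divide_distrib)
    finally show ?thesis .
  qed
  have int_q: "integrable N (q n)" for n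
    unfolding q_def[abs_def] using int_p[of "t n"] int_p[of 0] t[of n] e by simp
  have bound_int: "integrable N (\<lambda>v. (p e v + p (- e) v) / e)"
    using int_p[of e] int_p[of "- e"] e by simp
  \<comment> \<open>Inherited as a pointwise limit of the integrable \<open>q n\<close>;
    integrability is assumed for whole sums, not for single summands.\<close>
  have meas: "?D \<in> borel_measurable N"
    using borel_measurable_integrable[OF int_q] q_tendsto
    by (rule borel_measurable_LIMSEQ_real[rotated])
  note conv = meas borel_measurable_integrable[OF int_q] bound_int
    AE_I2[OF q_tendsto] AE_I2[OF q_bound]
  show "integrable N ?D"
    by (rule integrable_dominated_convergence[OF conv])
  have "d \<bullet> M \<le> (LINT v|N. q n v)" for n
  proof -
    have "lam + t n *\<^sub>R d \<in> L" using line[of "t n"] t[of n] by simp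
    then have "(LINT v|N. p 0 v) - lam \<bullet> M \<le> (LINT v|N. p (t n) v) - (lam + t n *\<^sub>R d) \<bullet> M"
      using min by (simp add: is_arg_min_def p_def not_less)
    then have "t n * (d \<bullet> M) \<le> (LINT v|N. p (t n) v) - (LINT v|N. p 0 v)"
      by (simp add: inner_add_left)
    also have "\<dots> = t n * (LINT v|N. q n v)"
      unfolding q_def using int_p[of "t n"] int_p[of 0] t[of n] e by simp
    finally show ?thesis using t by simp
  qed
  with integral_dominated_convergence[OF conv] show "d \<bullet> M \<le> (LINT v|N. ?D v)"
    by (intro LIMSEQ_le_const) auto
qed

text \<open>The directional inequalities for \<open>b\<close> and \<open>- b\<close> together give
  equality for each basis vector \<open>b\<close>; the components then reassemble to the
  vector-valued moment.\<close>

lemma exp_minimizer_moments: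
  fixes a :: "'i \<Rightarrow> 'v \<Rightarrow> 'e::euclidean_space" and w :: "'i \<Rightarrow> 'v \<Rightarrow> real"
  assumes "open L"
    and "\<And>i v. i \<in> I \<Longrightarrow> 0 \<le> w i v"
    and "\<And>\<alpha>. \<alpha> \<in> L \<Longrightarrow> integrable N (\<lambda>v. \<Sum>i\<in>I. w i v * exp (\<alpha> \<bullet> a i v))"
    and "is_arg_min (\<lambda>\<alpha>. (LINT v|N. (\<Sum>i\<in>I. w i v * exp (\<alpha> \<bullet> a i v))) - \<alpha> \<bullet> M) (\<lambda>\<alpha>. \<alpha> \<in> L) lam"
  shows "has_bochner_integral N (\<lambda>v. \<Sum>i\<in>I. (w i v * exp (lam \<bullet> a i v)) *\<^sub>R a i v) M"
proof -
  define F where "F v = (\<Sum>i\<in>I. (w i v * exp (lam \<bullet> a i v)) *\<^sub>R a i v)" for v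
  have F: "F v \<bullet> d = (\<Sum>i\<in>I. w i v * exp (lam \<bullet> a i v) * (d \<bullet> a i v))" for v d
    by (simp add: F_def inner_sum_left inner_commute[of d])
  note directional = exp_minimizer_directional[of L I w N a M lam, OF assms, folded F]
  have "has_bochner_integral N (\<lambda>v. F v \<bullet> b) (M \<bullet> b)" for b
    using directional[of b] directional(2)[of "- b"]
    by (simp add: has_bochner_integral_iff inner_commute)
  then have "has_bochner_integral N (\<lambda>v. \<Sum>b\<in>Basis. (F v \<bullet> b) *\<^sub>R b) (\<Sum>b\<in>Basis. (M \<bullet> b) *\<^sub>R b)"
    by (intro has_bochner_integral_sum has_bochner_integral_scaleR_left)
  then show ?thesis
    by (simp add: euclidean_representation F_def)
qed

section \<open>Moments of the collision term of an implicit stage\<close>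

lemma UNIV_species: "UNIV = {S1, S2}"
  using species.exhaust by auto

text \<open>Places one-species moments in the common space of \<open>a_mix\<close>, with the mass in
  the slot of that species, so that self and cross collisions can be added there.\<close>

fun embed :: "species \<Rightarrow> real \<times> vel \<times> real \<Rightarrow> real \<times> real \<times> vel \<times> real" where
  "embed S1 x = (fst x, 0, snd x)"
| "embed S2 x = (0, fst x, snd x)"

lemma bounded_linear_embed: "bounded_linear (embed i)"
proof (cases i)
  case S1
  have "bounded_linear (\<lambda>x :: real \<times> vel \<times> real. (fst x, 0 :: real, snd x))"
    by (intro bounded_linear_intros)
  also have "(\<lambda>x. (fst x, 0, snd x)) = embed i"
    by (simp add: S1 fun_eq_iff)
  finally show ?thesis .
next
  case S2
  have "bounded_linear (\<lambda>x :: real \<times> vel \<times> real. (0 :: real, fst x, snd x))"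
    by (intro bounded_linear_intros)
  also have "(\<lambda>x. (0, fst x, snd x)) = embed i"
    by (simp add: S2 fun_eq_iff)
  finally show ?thesis .
qed

lemma a_mix_eq_embed: "a_mix m i v = embed i (a_self m i v)"
  by (cases i) (simp_all add: a_self_def zero_prod_def)

text \<open>The integrand of all conserved quantities at once: the two masses, total momentum, total energy.\<close>

definition conserved :: "(species \<Rightarrow> real) \<Rightarrow> (species \<Rightarrow> vel \<Rightarrow> real) \<Rightarrow> vel \<Rightarrow> real \<times> real \<times> vel \<times> real"
  where "conserved m h v = h S1 v *\<^sub>R a_mix m S1 v + h S2 v *\<^sub>R a_mix m S2 v"

text \<open>Eliminates \<open>stage_psi\<close> by means of \<open>coeff \<tau> \<nu> i v * (1 +
  \<tau> * (\<nu> i i v + \<nu> i (other i) v)) = 1\<close>. The result has the weights of the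
  potentials and compares with \<open>G\<close>, as the optimality conditions do.\<close>

lemma stage_R_eq:
  assumes "0 < \<tau>" "\<And>i j v. 0 \<le> \<nu> i j v"
  shows "stage_R m \<tau> \<nu> G i v = coeff \<tau> \<nu> i v * \<nu> i i v * (A_self m \<tau> \<nu> G i v - G i v)
    + coeff \<tau> \<nu> i v * \<nu> i (other i) v * (A_mix m \<tau> \<nu> G i v - G i v)"
proof -
  have "0 \<le> \<tau> * (\<nu> i i v + \<nu> i (other i) v)"
    using assms by simp
  then have "coeff \<tau> \<nu> i v * (1 + \<tau> * (\<nu> i i v + \<nu> i (other i) v)) = 1"
    by (simp add: coeff_def)
  then show ?thesis
    unfolding stage_R_def stage_psi_def by algebra
qed

lemma coeff_nonneg:
  assumes "0 < \<tau>" "\<And>i j v. 0 \<le> \<nu> i j v"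
  shows "0 \<le> coeff \<tau> \<nu> i v"
  using assms by (simp add: coeff_def)

text \<open>Optimality equates the weighted moments of \<open>A_self\<close> with the integral of
  \<open>data_self\<close>, which holds the same moments of \<open>G\<close>; the two are
  subtracted.\<close>

lemma self_collision_moments:
  assumes "0 < \<tau>" "\<And>i j v. 0 \<le> \<nu> i j v" and wp: "stage_wellposed m \<tau> \<nu> G"
  shows "has_bochner_integral lborel
    (\<lambda>v. (coeff \<tau> \<nu> i v * \<nu> i i v * (A_self m \<tau> \<nu> G i v - G i v)) *\<^sub>R a_self m i v) 0"
proof -
  have "is_arg_min (potential_self m \<tau> \<nu> G i) (\<lambda>\<alpha>. \<alpha> \<in> Lambda_self) (lam_self m \<tau> \<nu> G i)"
    unfolding lam_self_def arg_min_def using wp unfolding stage_wellposed_def by (metis someI_ex)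
  moreover have "open Lambda_self"
    unfolding Lambda_self_def by (intro open_Times) auto
  \<comment> \<open>The singleton index set \<open>{i}\<close> reduces the general potential to that
    of species \<open>i\<close>.\<close>
  ultimately have "has_bochner_integral lborel
      (\<lambda>v. (coeff \<tau> \<nu> i v * \<nu> i i v * A_self m \<tau> \<nu> G i v) *\<^sub>R a_self m i v)
      (LINT v|lborel. data_self m \<tau> \<nu> G i v)"
    using exp_minimizer_moments[of Lambda_self "{i}" "\<lambda>i v. coeff \<tau> \<nu> i v * \<nu> i i v" lborel
        "a_self m" "LINT v|lborel. data_self m \<tau> \<nu> G i v" "lam_self m \<tau> \<nu> G i"]
      wp assms coeff_nonneg[OF assms(1,2)]
    by (simp add: stage_wellposed_def exp_self_def[abs_def] potential_self_def[abs_def] A_self_def)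
  moreover have "has_bochner_integral lborel (data_self m \<tau> \<nu> G i) (LINT v|lborel. data_self m \<tau> \<nu> G i v)"
    using wp by (simp add: stage_wellposed_def has_bochner_integral_iff)
  ultimately show ?thesis
    using has_bochner_integral_diff by (fastforce simp: data_self_def[abs_def] algebra_simps)
qed

text \<open>Both species share the multiplier \<open>lam_mix\<close>, so optimality balances each
  mass separately but momentum and energy only in total.\<close>

lemma mixed_collision_moments:
  assumes "0 < \<tau>" "\<And>i j v. 0 \<le> \<nu> i j v" and wp: "stage_wellposed m \<tau> \<nu> G"
  shows "has_bochner_integral lborel
    (conserved m (\<lambda>i v. coeff \<tau> \<nu> i v * \<nu> i (other i) v * (A_mix m \<tau> \<nu> G i v - G i v))) 0"
proof -
  have "is_arg_min (potential_mix m \<tau> \<nu> G) (\<lambda>\<alpha>. \<alpha> \<in> Lambda_mix) (lam_mix m \<tau> \<nu> G)"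
    unfolding lam_mix_def arg_min_def using wp unfolding stage_wellposed_def by (metis someI_ex)
  moreover have "open Lambda_mix"
    unfolding Lambda_mix_def by (intro open_Times) auto
  \<comment> \<open>Here the index set is all of \<open>species\<close>, and the sum over it is
    \<open>conserved\<close>.\<close>
  ultimately have "has_bochner_integral lborel
      (conserved m (\<lambda>i v. coeff \<tau> \<nu> i v * \<nu> i (other i) v * A_mix m \<tau> \<nu> G i v))
      (LINT v|lborel. data_mix m \<tau> \<nu> G v)"
    using exp_minimizer_moments[of Lambda_mix UNIV "\<lambda>i v. coeff \<tau> \<nu> i v * \<nu> i (other i) v" lborel
        "a_mix m" "LINT v|lborel. data_mix m \<tau> \<nu> G v" "lam_mix m \<tau> \<nu> G"]
      wp assms coeff_nonneg[OF assms(1,2)]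
    by (simp add: stage_wellposed_def exp_mix_def[abs_def] potential_mix_def[abs_def] A_mix_def
        UNIV_species conserved_def[abs_def] del: a_mix.simps)
  moreover have "has_bochner_integral lborel (data_mix m \<tau> \<nu> G) (LINT v|lborel. data_mix m \<tau> \<nu> G v)"
    using wp by (simp add: stage_wellposed_def has_bochner_integral_iff)
  ultimately have "has_bochner_integral lborel
     (\<lambda>v. conserved m (\<lambda>i v. coeff \<tau> \<nu> i v * \<nu> i (other i) v * A_mix m \<tau> \<nu> G i v) v - data_mix m \<tau> \<nu> G v) 0"
    using has_bochner_integral_diff by fastforce
  moreover have "conserved m (\<lambda>i v. coeff \<tau> \<nu> i v * \<nu> i (other i) v * (A_mix m \<tau> \<nu> G i v - G i v))
      = (\<lambda>v. conserved m (\<lambda>i v. coeff \<tau> \<nu> i v * \<nu> i (other i) v * A_mix m \<tau> \<nu> G i v) v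
          - data_mix m \<tau> \<nu> G v)"
    by (simp add: fun_eq_iff conserved_def data_mix_def right_diff_distrib scaleR_left_diff_distrib del: a_mix.simps)
  ultimately show ?thesis
    by simp
qed

lemma collision_conserved:
  assumes "0 < \<tau>" "\<And>i j v. 0 \<le> \<nu> i j v" "stage_wellposed m \<tau> \<nu> G"
  shows "has_bochner_integral lborel (conserved m (stage_R m \<tau> \<nu> G)) 0"
proof -
  define s where "s i v = coeff \<tau> \<nu> i v * \<nu> i i v * (A_self m \<tau> \<nu> G i v - G i v)" for i v
  define x where "x i v = coeff \<tau> \<nu> i v * \<nu> i (other i) v * (A_mix m \<tau> \<nu> G i v - G i v)" for i v
  interpret embed: bounded_linear "embed i" for i by (rule bounded_linear_embed)
  \<comment> \<open>A bounded linear map commutes with the integral, so the zero self-collision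
    moment stays zero under \<open>embed i\<close>.\<close>
  have "has_bochner_integral lborel (\<lambda>v. s i v *\<^sub>R a_mix m i v) 0" for i
    using has_bochner_integral_bounded_linear[OF bounded_linear_embed self_collision_moments[OF assms]]
    by (simp add: s_def a_mix_eq_embed embed.scaleR embed.zero)
  moreover have "has_bochner_integral lborel (conserved m x) 0"
    unfolding x_def[abs_def] by (rule mixed_collision_moments[OF assms])
  ultimately have "has_bochner_integral lborel
      (\<lambda>v. s S1 v *\<^sub>R a_mix m S1 v + s S2 v *\<^sub>R a_mix m S2 v + conserved m x v) (0 + 0 + 0)"
    by (intro has_bochner_integral_add)
  moreover have "conserved m (stage_R m \<tau> \<nu> G)
      = (\<lambda>v. s S1 v *\<^sub>R a_mix m S1 v + s S2 v *\<^sub>R a_mix m S2 v + conserved m x v)"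
    by (simp add: fun_eq_iff conserved_def stage_R_eq[OF assms(1,2)] s_def x_def scaleR_left_distrib
        del: a_mix.simps)
  ultimately show ?thesis by simp
qed

section \<open>Telescoping of the discrete transport\<close>

lemma integrable_conserved:
  assumes "\<And>i. finite_moments (h i)"
  shows "integrable lborel (conserved m h)"
proof -
  interpret embed: bounded_linear "embed i" for i by (rule bounded_linear_embed)
  have "integrable lborel (\<lambda>v. h i v *\<^sub>R a_mix m i v)" for i
  proof -
    have "integrable lborel (\<lambda>v. m i *\<^sub>R embed i (h i v *\<^sub>R (1, v, (norm v)\<^sup>2)))"
      using assms unfolding finite_moments_def
      by (intro integrable_scaleR_right integrable_bounded_linear[OF bounded_linear_embed]) auto
    then show ?thesis
      by (simp add: a_mix_eq_embed a_self_def embed.scaleR mult.commute del: scaleR_Pair)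
  qed
  then show ?thesis
    unfolding conserved_def[abs_def] by (intro Bochner_Integration.integrable_add)
qed

lemma sum_int_telescope:
  fixes F :: "int \<Rightarrow> 'a::ab_group_add"
  shows "(\<Sum>k\<in>{0..int n}. F k - F (k - 1)) = F (int n) - F (- 1)"
proof (induction n)
  case (Suc n)
  have "{0..int (Suc n)} = insert (int (Suc n)) {0..int n}" by auto
  then show ?case using Suc by simp
qed simp

text \<open>Periodicity identifies the stencils of the two boundary interfaces; for zero conditions
  both fluxes are 0 by definition.\<close>

lemma flux_boundary:
  assumes "ghost_values bc K g"
  shows "flux bc sd K g (int K) = flux bc sd K g (- 1)"
proof (cases bc)
  case Periodic
  then have per: "g (k + (int K + 1)) = g k" for k
    using assms by (simp add: ghost_values_def)
  \<comment> \<open>The limiter at interface \<open>k\<close> reads cells \<open>k - 1\<close> to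
    \<open>k + 2\<close>, so the cells -2 to 1 have to be matched with those shifted by
    \<open>int K + 1\<close>.\<close>
  have "g (int K) = g (- 1)" "g (int K + 1) = g 0" "g (int K + 2) = g 1" "g (int K - 1) = g (- 2)"
    using per[of "- 1"] per[of 0] per[of 1] per[of "- 2"] by (simp_all add: algebra_simps)
  with Periodic show ?thesis
    by (cases sd) (simp_all add: flux_def fun_eq_iff)
qed (simp add: flux_def fun_eq_iff)

text \<open>The integrated interface fluxes telescope over the cells, leaving the difference of the
  boundary fluxes. The space discretization enters only through \<open>flux\<close>, so both choices
  are treated at once.\<close>

lemma transport_conserved:
  assumes "\<And>i. ghost_values bc K (g i)" "flux_moments bc sd K g"
  shows "\<And>k. k \<in> {0..int K} \<Longrightarrow>
      integrable lborel (conserved m (\<lambda>i. transport bc sd K \<Delta>x (g i) k))" (is "\<And>k. _ \<Longrightarrow> ?int k")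
    and "(\<Sum>k\<in>{0..int K}. LINT v|lborel. conserved m (\<lambda>i. transport bc sd K \<Delta>x (g i) k) v) = 0"
proof -
  define F where "F k = conserved m (\<lambda>i. flux bc sd K (g i) k)" for k
  \<comment> \<open>The range starts at -1 because the left interface of cell 0 has that
    index.\<close>
  have F: "integrable lborel (F k)" if "k \<in> {-1..int K}" for k
    unfolding F_def using assms(2) that by (intro integrable_conserved) (auto simp: flux_moments_def)
  have T: "conserved m (\<lambda>i. transport bc sd K \<Delta>x (g i) k) = (\<lambda>v. (1 / \<Delta>x) *\<^sub>R (F k v - F (k - 1) v))" for k
    by (simp add: fun_eq_iff F_def conserved_def transport_def algebra_simps diff_divide_distrib
        del: a_mix.simps)
  show "?int k" if "k \<in> {0..int K}" for k
    unfolding T using that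
    by (intro integrable_scaleR_right Bochner_Integration.integrable_diff F) auto
  have "(\<Sum>k\<in>{0..int K}. LINT v|lborel. conserved m (\<lambda>i. transport bc sd K \<Delta>x (g i) k) v)
      = (\<Sum>k\<in>{0..int K}. (1 / \<Delta>x) *\<^sub>R ((LINT v|lborel. F k v) - (LINT v|lborel. F (k - 1) v)))"
    unfolding T by (intro sum.cong) (auto simp: F)
  also have "\<dots> = (1 / \<Delta>x) *\<^sub>R ((LINT v|lborel. F (int K) v) - (LINT v|lborel. F (- 1) v))"
    by (simp only: scaleR_sum_right[symmetric]
        sum_int_telescope[of "\<lambda>k. LINT v|lborel. F k v"])
  also have "\<dots> = 0"
    by (simp add: F_def flux_boundary[OF assms(1)])
  finally show "(\<Sum>k\<in>{0..int K}. LINT v|lborel. conserved m (\<lambda>i. transport bc sd K \<Delta>x (g i) k) v) = 0" .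
qed

section \<open>Conservation for the two time discretizations\<close>

lemma splitting_conserves:
  assumes "0 < \<Delta>t" "\<And>i j k v. k \<in> {0..int K} \<Longrightarrow> 0 \<le> \<nu> i j k v"
    and step: "splitting_step m \<Delta>t \<Delta>x K bc sd \<nu> f f' fnew"
    and standing: "splitting_standing m \<Delta>t K bc sd \<nu> f f' fnew"
  shows "(\<Sum>k\<in>{0..int K}. LINT v|lborel. conserved m (dist_at fnew k) v)
    = (\<Sum>k\<in>{0..int K}. LINT v|lborel. conserved m (dist_at f k) v)"
proof -
  define T where "T k = conserved m (\<lambda>i. transport bc sd K \<Delta>x (f' i) k)" for k
  have ghost: "\<And>i. ghost_values bc K (f' i)" and flux: "flux_moments bc sd K f'"
    using step standing by (auto simp: splitting_step_def splitting_standing_def)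
  note T = transport_conserved[OF ghost flux, where m = m and \<Delta>x = \<Delta>x, folded T_def]
  \<comment> \<open>In each cell the collision integral is zero, so only transport changes the
    moments; its sum over the cells then vanishes by \<open>T(2)\<close>.\<close>
  have "(LINT v|lborel. conserved m (dist_at fnew k) v)
      = (LINT v|lborel. conserved m (dist_at f k) v) - \<Delta>t *\<^sub>R (LINT v|lborel. T k v)"
    if k: "k \<in> {0..int K}" for k
  proof -
    define R where "R = stage_R m \<Delta>t (freq_at \<nu> k) (dist_at f k)"
    have nn: "\<And>i j v. 0 \<le> freq_at \<nu> k i j v" using assms(2) k by (simp add: freq_at_def)
    have "stage_wellposed m \<Delta>t (freq_at \<nu> k) (dist_at f k)"
      using standing k by (simp add: splitting_standing_def)
    note R = collision_conserved[OF assms(1) nn this, folded R_def]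
    have f: "integrable lborel (conserved m (dist_at f k))"
      using standing k
      by (intro integrable_conserved) (auto simp: splitting_standing_def dist_moments_def dist_at_def)
    have "dist_at fnew k i v = dist_at f k i v + \<Delta>t * R i v - \<Delta>t * transport bc sd K \<Delta>x (f' i) k v" for i v
      using step k stage_psi_eq_R[OF assms(1) nn]
      by (simp add: splitting_step_def dist_at_def R_def)
    then have "conserved m (dist_at fnew k)
        = (\<lambda>v. conserved m (dist_at f k) v + \<Delta>t *\<^sub>R conserved m R v - \<Delta>t *\<^sub>R T k v)"
      by (simp add: fun_eq_iff conserved_def T_def del: a_mix.simps)
        (simp add: algebra_simps del: a_mix.simps)
    then show ?thesis
      using f R T(1)[OF k] by (simp add: has_bochner_integral_iff)
  qed
  then show ?thesis
    using T(2) by (simp add: sum_subtractf scaleR_sum_right[symmetric])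
qed

lemma imex_gamma_pos: "0 < imex_gamma"
proof -
  have "sqrt 2 < sqrt 4" by (intro real_sqrt_less_mono) simp
  then show ?thesis by (simp add: imex_gamma_def)
qed

text \<open>Since \<open>f2\<close> is \<open>G2\<close> plus a multiple of its collision term, the
  whole step adds to \<open>f\<close> the transports of \<open>f\<close> and \<open>f1\<close> and
  the collision terms of both stages. The first stage matters only through \<open>f1\<close> and its
  collision term.\<close>

lemma imex_conserves:
  assumes "0 < \<Delta>t" "\<And>r i j k v. k \<in> {0..int K} \<Longrightarrow> 0 \<le> \<nu> r i j k v"
    and step: "imex_step m \<Delta>t \<Delta>x K bc sd \<nu> f G1 f1 G2 f2 fnew"
    and standing: "imex_standing m \<Delta>t K bc sd \<nu> f G1 f1 G2 f2 fnew"
  shows "(\<Sum>k\<in>{0..int K}. LINT v|lborel. conserved m (dist_at fnew k) v)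
    = (\<Sum>k\<in>{0..int K}. LINT v|lborel. conserved m (dist_at f k) v)"
proof -
  define T where "T g k = conserved m (\<lambda>i. transport bc sd K \<Delta>x (g i) k)" for g k
  define \<tau> where "\<tau> = imex_gamma * \<Delta>t"
  have \<tau>: "0 < \<tau>" using assms(1) imex_gamma_pos by (simp add: \<tau>_def)
  have ghost: "\<And>i. ghost_values bc K (f i)" "\<And>i. ghost_values bc K (f1 i)"
    and flux: "flux_moments bc sd K f" "flux_moments bc sd K f1"
    using step standing by (auto simp: imex_step_def imex_standing_def Let_def)
  note T = transport_conserved[OF ghost(1) flux(1), where m = m and \<Delta>x = \<Delta>x, folded T_def]
    transport_conserved[OF ghost(2) flux(2), where m = m and \<Delta>x = \<Delta>x, folded T_def]
  define c1 c2 where "c1 = imex_delta * \<Delta>t" and "c2 = (1 - imex_delta) * \<Delta>t"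
  define c3 where "c3 = (1 - imex_gamma) * \<Delta>t"
  \<comment> \<open>Both collision integrals have dropped out; the two transport integrals cancel
    only after summation over the cells.\<close>
  have "(LINT v|lborel. conserved m (dist_at fnew k) v)
      = (LINT v|lborel. conserved m (dist_at f k) v)
        - c1 *\<^sub>R (LINT v|lborel. T f k v) - c2 *\<^sub>R (LINT v|lborel. T f1 k v)"
    if k: "k \<in> {0..int K}" for k
  proof -
    define R1 R2 where "R1 = stage_R m \<tau> (freq_at (\<nu> 1) k) (dist_at G1 k)"
      and "R2 = stage_R m \<tau> (freq_at (\<nu> 2) k) (dist_at G2 k)"
    have nn: "\<And>r i j v. 0 \<le> freq_at (\<nu> r) k i j v" using assms(2) k by (simp add: freq_at_def)
    have "stage_wellposed m \<tau> (freq_at (\<nu> 1) k) (dist_at G1 k)"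
      "stage_wellposed m \<tau> (freq_at (\<nu> 2) k) (dist_at G2 k)"
      using standing k by (simp_all add: imex_standing_def \<tau>_def)
    note R = this[THEN collision_conserved[OF \<tau> nn], folded R1_def R2_def]
    have f: "integrable lborel (conserved m (dist_at f k))"
      using standing k
      by (intro integrable_conserved) (auto simp: imex_standing_def dist_moments_def dist_at_def)
    have "dist_at fnew k i v = dist_at f k i v - c1 * transport bc sd K \<Delta>x (f i) k v
        - c2 * transport bc sd K \<Delta>x (f1 i) k v + c3 * R1 i v + \<tau> * R2 i v" for i v
    proof -
      have "fnew i k v = stage_psi m \<tau> (freq_at (\<nu> 2) k) (dist_at G2 k) i v"
        using step k unfolding imex_step_def Let_def \<tau>_def by metis
      also have "\<dots> = G2 i k v + \<tau> * R2 i v"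
        using stage_psi_eq_R[OF \<tau> nn] by (simp add: R2_def dist_at_def)
      also have "G2 i k v = f i k v - c1 * transport bc sd K \<Delta>x (f i) k v
          - c2 * transport bc sd K \<Delta>x (f1 i) k v + c3 * R1 i v"
        using step k unfolding imex_step_def Let_def \<tau>_def R1_def c1_def c2_def c3_def by metis
      finally show ?thesis by (simp add: dist_at_def)
    qed
    then have "conserved m (dist_at fnew k)
        = (\<lambda>v. conserved m (dist_at f k) v - c1 *\<^sub>R T f k v - c2 *\<^sub>R T f1 k v
             + c3 *\<^sub>R conserved m R1 v + \<tau> *\<^sub>R conserved m R2 v)"
      by (simp add: fun_eq_iff conserved_def T_def del: a_mix.simps)
        (simp add: algebra_simps del: a_mix.simps)
    then show ?thesis
      using f R T(1,3)[OF k] by (simp add: has_bochner_integral_iff)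
  qed
  then show ?thesis
    using T(2,4) by (simp add: sum_subtractf scaleR_sum_right[symmetric])
qed

section \<open>Reading off masses, momentum and energy\<close>

text \<open>The coordinate projections are bounded linear and commute with the integral. Momentum
  and energy stay paired, as in the final statement.\<close>

lemma integral_conserved:
  assumes "integrable lborel (conserved m h)"
  shows "(LINT v|lborel. conserved m h v) =
    (LINT v|lborel. m S1 * h S1 v, LINT v|lborel. m S2 * h S2 v,
     LINT v|lborel. (m S1 * h S1 v + m S2 * h S2 v) *\<^sub>R (v, (norm v)\<^sup>2))"
proof -
  have eq: "conserved m h = (\<lambda>v. (m S1 * h S1 v, m S2 * h S2 v,
      (m S1 * h S1 v + m S2 * h S2 v) *\<^sub>R (v, (norm v)\<^sup>2)))"
    by (simp add: fun_eq_iff conserved_def algebra_simps)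
  have "bounded_linear (\<lambda>x :: real \<times> real \<times> vel \<times> real. fst (snd x))"
    "bounded_linear (\<lambda>x :: real \<times> real \<times> vel \<times> real. snd (snd x))"
    by (intro bounded_linear_intros)+
  from bounded_linear_fst[THEN integral_bounded_linear, OF assms]
    this[THEN integral_bounded_linear, OF assms]
  show ?thesis by (simp add: eq prod_eq_iff del: scaleR_Pair)
qed

theorem corollary5p1:
  fixes m :: "species \<Rightarrow> real" and \<Delta>t \<Delta>x :: real and K :: nat
    and bc :: boundary and td :: time_disc and sd :: space_disc
    and \<nu> :: "nat \<Rightarrow> nat \<Rightarrow> species \<Rightarrow> species \<Rightarrow> grid"
      \<comment> \<open>\<open>\<nu> l r\<close>: frequencies of implicit stage \<open>r\<close> of step \<open>l\<close>; the splitting only has \<open>r = 1\<close>\<close>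
    and f :: "nat \<Rightarrow> dist" and f' G1 f1 G2 f2 :: dist and l :: nat
  assumes "\<And>i. 0 < m i" and "0 < \<Delta>t" and "0 < \<Delta>x"
    and "\<And>r i j k v. k \<in> {0..int K} \<Longrightarrow> 0 \<le> \<nu> l r i j k v"
    and "case td of
        Splitting \<Rightarrow>
          splitting_step m \<Delta>t \<Delta>x K bc sd (\<nu> l 1) (f l) f' (f (Suc l)) \<and>
          splitting_standing m \<Delta>t K bc sd (\<nu> l 1) (f l) f' (f (Suc l))
      | IMEX_RK \<Rightarrow>
          imex_step m \<Delta>t \<Delta>x K bc sd (\<nu> l) (f l) G1 f1 G2 f2 (f (Suc l)) \<and>
          imex_standing m \<Delta>t K bc sd (\<nu> l) (f l) G1 f1 G2 f2 (f (Suc l))"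
  shows "(\<forall>i. (\<Sum>k\<in>{0..int K}. (LINT v|lborel. m i * f (Suc l) i k v) * \<Delta>x)
            = (\<Sum>k\<in>{0..int K}. (LINT v|lborel. m i * f l i k v) * \<Delta>x))
    \<and> (\<Sum>k\<in>{0..int K}. \<Delta>x *\<^sub>R (LINT v|lborel.
          (m S1 * f (Suc l) S1 k v + m S2 * f (Suc l) S2 k v) *\<^sub>R (v, (norm v)\<^sup>2)))
      = (\<Sum>k\<in>{0..int K}. \<Delta>x *\<^sub>R (LINT v|lborel.
          (m S1 * f l S1 k v + m S2 * f l S2 k v) *\<^sub>R (v, (norm v)\<^sup>2)))"
proof -
  have moments: "dist_moments K (f l)" "dist_moments K (f (Suc l))"
    using assms(5) by (cases td; simp add: splitting_standing_def imex_standing_def)+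
  have total: "(\<Sum>k\<in>{0..int K}. LINT v|lborel. conserved m (dist_at (f (Suc l)) k) v)
    = (\<Sum>k\<in>{0..int K}. LINT v|lborel. conserved m (dist_at (f l) k) v)"
  proof (cases td)
    case Splitting
    then show ?thesis using assms by (intro splitting_conserves[where \<nu> = "\<nu> l 1" and f' = f' and \<Delta>x = \<Delta>x]) auto
  next
    case IMEX_RK
    then show ?thesis using assms by (intro imex_conserves[where \<nu> = "\<nu> l" and \<Delta>x = \<Delta>x]) auto
  qed
  \<comment> \<open>Bundles the integrals of the claim, so that each conservation law is a
    projection of one equation.\<close>
  define P where "P h k = (LINT v|lborel. m S1 * h S1 k v, LINT v|lborel. m S2 * h S2 k v,
     LINT v|lborel. (m S1 * h S1 k v + m S2 * h S2 k v) *\<^sub>R (v, (norm v)\<^sup>2))"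
    for h :: dist and k
  have "(LINT v|lborel. conserved m (dist_at h k) v) = P h k"
    if "dist_moments K h" "k \<in> {0..int K}" for h k
  proof -
    have "integrable lborel (conserved m (dist_at h k))"
      using that by (intro integrable_conserved) (auto simp: dist_moments_def dist_at_def)
    from integral_conserved[OF this] show ?thesis
      by (simp add: dist_at_def P_def)
  qed
  with total moments have P: "(\<Sum>k\<in>{0..int K}. P (f (Suc l)) k) = (\<Sum>k\<in>{0..int K}. P (f l) k)"
    by simp
  have mass: "(\<Sum>k\<in>{0..int K}. LINT v|lborel. m i * f (Suc l) i k v)
      = (\<Sum>k\<in>{0..int K}. LINT v|lborel. m i * f l i k v)" for i
    using arg_cong[OF P, of fst] arg_cong[OF P, of "\<lambda>x. fst (snd x)"]
    by (cases i) (simp_all add: P_def fst_sum snd_sum)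
  have energy: "(\<Sum>k\<in>{0..int K}. LINT v|lborel.
        (m S1 * f (Suc l) S1 k v + m S2 * f (Suc l) S2 k v) *\<^sub>R (v, (norm v)\<^sup>2))
      = (\<Sum>k\<in>{0..int K}. LINT v|lborel. (m S1 * f l S1 k v + m S2 * f l S2 k v) *\<^sub>R (v, (norm v)\<^sup>2))"
    using arg_cong[OF P, of "\<lambda>x. snd (snd x)"] by (simp add: P_def snd_sum del: scaleR_Pair)
  show ?thesis
    by (simp only: sum_distrib_right[symmetric] scaleR_sum_right[symmetric] mass energy simp_thms)
qed

end
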